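(* Let $G=(V,E)$ be a graph with maximal degree $D$, and let $p_4(D)=\frac{D^2(D+1)^2}{2}-1$. Then there is a splitting of $G$ with $p_4(D)$ colors such that each graph $G_i$ of the splitting is a disjoint union of edges and vertices.
   Context: Graphs are finite, and edges are unordered pairs $\{v_1,v_2\}$ of distinct vertices. A splitting of $G=(V,E)$ is defined as follows. Let $M$ be a finite set, whose elements are called colors, and let $w:V\to\mathbb{Z}^M$ be a weighting of the vertices. Define $w:E\to\mathbb{Z}^M$ by $w(\{v_1,v_2\})=w(v_1)+w(v_2)$, and suppose that for each edge $e\in E$ the sequence $w(e)=(w(e)_i)_{i\in M}$ has a maximum, meaning that its largest value is attained at a unique index. The resulting splitting of $G$ consists of the graphs $G_i=(V,E_i)$ for $i\in M$, where $E_i=\{e\in E\mid \max(w(e))=w(e)_i\}$. It is a splitting with $|M|$ colors. A graph is a disjoint union of edges and vertices if each of its connected components is a single vertex or a single edge. *)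

theory Defs imports Main
begin

type_synonym 'a graph = "'a set \<times> 'a set set"

abbreviation verts :: "'a graph \<Rightarrow> 'a set" where "verts G \<equiv> fst G"
abbreviation edges :: "'a graph \<Rightarrow> 'a set set" where "edges G \<equiv> snd G"

definition is_graph :: "'a graph \<Rightarrow> bool" where
  "is_graph G \<longleftrightarrow> finite (verts G) \<and>
     (\<forall>e\<in>edges G. \<exists>u v. u \<in> verts G \<and> v \<in> verts G \<and> u \<noteq> v \<and> e = {u, v})"

definition degree :: "'a graph \<Rightarrow> 'a \<Rightarrow> nat" where
  "degree G v = card {e \<in> edges G. v \<in> e}"

(* The inserted 0 only matters for the graph without vertices, whose maximal degree is 0. *)
definition max_degree :: "'a graph \<Rightarrow> nat" where
  "max_degree G = Max (insert 0 (degree G ` verts G))"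

(* An element of Z^M is a function on colors whose values outside M are never used. *)
definition edge_weight :: "('a \<Rightarrow> 'c \<Rightarrow> int) \<Rightarrow> 'a set \<Rightarrow> 'c \<Rightarrow> int" where
  "edge_weight w e i = (\<Sum>v\<in>e. w v i)"

definition has_maximum :: "'c set \<Rightarrow> ('c \<Rightarrow> int) \<Rightarrow> bool" where
  "has_maximum M x \<longleftrightarrow> (\<exists>!i. i \<in> M \<and> (\<forall>j\<in>M. x j \<le> x i))"

definition split_graph ::
    "'a graph \<Rightarrow> 'c set \<Rightarrow> ('a \<Rightarrow> 'c \<Rightarrow> int) \<Rightarrow> 'c \<Rightarrow> 'a graph" where
  "split_graph G M w i =
     (verts G, {e \<in> edges G. Max (edge_weight w e ` M) = edge_weight w e i})"

definition is_splitting :: "'a graph \<Rightarrow> 'c set \<Rightarrow> ('c \<Rightarrow> 'a graph) \<Rightarrow> bool" where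
  "is_splitting G M H \<longleftrightarrow> finite M \<and>
     (\<exists>w. (\<forall>e\<in>edges G. has_maximum M (edge_weight w e)) \<and>
          (\<forall>i\<in>M. H i = split_graph G M w i))"

definition connected_rel :: "'a graph \<Rightarrow> ('a \<times> 'a) set" where
  "connected_rel G = {(u, v). u \<in> verts G \<and> v \<in> verts G \<and>
                       (u, v) \<in> {(x, y). {x, y} \<in> edges G}\<^sup>*}"

definition induced_subgraph :: "'a graph \<Rightarrow> 'a set \<Rightarrow> 'a graph" where
  "induced_subgraph G C = (C, {e \<in> edges G. e \<subseteq> C})"

definition connected_components :: "'a graph \<Rightarrow> 'a graph set" where
  "connected_components G = induced_subgraph G ` (verts G // connected_rel G)"

definition disjoint_union_of_edges_and_vertices :: "'a graph \<Rightarrow> bool" where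
  "disjoint_union_of_edges_and_vertices G \<longleftrightarrow>
     (\<forall>C\<in>connected_components G.
        (\<exists>v. C = ({v}, {})) \<or> (\<exists>u v. u \<noteq> v \<and> C = ({u, v}, {{u, v}})))"

(* D (D + 1) is even, so the division by 2 is exact. For D \<ge> 1 the value is positive;
   p4 0 = -1, so a number of colors nat (p4 D) is the degenerate value 0 for an edgeless graph. *)
definition p4 :: "nat \<Rightarrow> int" where
  "p4 D = (int D)^2 * (int D + 1)^2 div 2 - 1"

end

theory Submission imports Defs begin

text \<open>
  Label the vertices so that any two distinct vertices at distance at most two get different
  labels. At most \<open>D\<^sup>2\<close> vertices lie within distance two of a given one, so a greedy choice
  (\<open>greedy_colouring\<close>) needs only \<open>D\<^sup>2 + 1\<close> labels (\<open>distance_two_labelling\<close>).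

  The colors of the splitting are the two-element sets of labels, and a vertex has weight 1 at
  the pairs that contain its label and weight 0 elsewhere. An edge joins two different labels, so
  its weight reaches 2 exactly at the pair formed by them, and that pair is its unique maximum.
  Two edges in the same \<open>G\<^sub>i\<close> that share a vertex have other ends with equal labels; these ends are
  at distance at most two, hence equal. So every \<open>G\<^sub>i\<close> is a matching.

  This takes \<open>(D\<^sup>2 + 1) D\<^sup>2 / 2\<close> colors, which for \<open>D \<ge> 1\<close> is \<open>D\<^sup>3 - 1\<close> less than \<open>p\<^sub>4(D)\<close>. The
  remaining colors are dummies at which all weights vanish: they never carry a maximum, and their
  graphs have no edges. For \<open>D = 0\<close> there are no edges and the empty set of colors works.
\<close>

section \<open>Matchings\<close>

text \<open>
  A walk that starts along an edge \<open>{v, u}\<close> can only go back and forth on it, since neither end has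
  another neighbor. So the component of \<open>v\<close> is that edge.
\<close>

lemma matching_is_disjoint_union:
  assumes graph: "is_graph G"
    and matching: "\<And>u v v'. {u, v} \<in> edges G \<Longrightarrow> {u, v'} \<in> edges G \<Longrightarrow> v = v'"
  shows "disjoint_union_of_edges_and_vertices G"
  unfolding disjoint_union_of_edges_and_vertices_def
proof
  fix C
  assume "C \<in> connected_components G"
  then obtain v where v: "v \<in> verts G"
    and C: "C = induced_subgraph G (connected_rel G `` {v})"
    unfolding connected_components_def quotient_def by auto
  define E where "E = {(x, y). {x, y} \<in> edges G}"
  have edgeD: "x \<noteq> y \<and> x \<in> verts G \<and> y \<in> verts G" if "{x, y} \<in> edges G" for x y
    using graph that unfolding is_graph_def by (metis doubleton_eq_iff)
  have edge_shape: "\<exists>x y. e = {x, y} \<and> x \<noteq> y" if "e \<in> edges G" for e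
    using graph that unfolding is_graph_def by blast
  have rel: "connected_rel G `` {v} = {u \<in> verts G. (v, u) \<in> E\<^sup>*}"
    using v by (auto simp: connected_rel_def E_def)
  show "(\<exists>v. C = ({v}, {})) \<or> (\<exists>u v. u \<noteq> v \<and> C = ({u, v}, {{u, v}}))"
  proof (cases "\<exists>u. {v, u} \<in> edges G")
    case True
    then obtain u where u: "{v, u} \<in> edges G" by blast
    have "y \<in> {v, u}" if "(v, y) \<in> E\<^sup>*" for y
      using that
    proof induction
      case (step y z)
      then show ?case
        using matching[of v u z] matching[of u v z] u by (auto simp: E_def insert_commute)
    qed simp
    then have "connected_rel G `` {v} = {v, u}"
      using v u edgeD[OF u] unfolding rel by (auto simp: E_def)
    moreover have "{e \<in> edges G. e \<subseteq> {v, u}} = {{v, u}}"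
      using u edge_shape by blast
    ultimately show ?thesis
      using edgeD[OF u] C by (auto simp: induced_subgraph_def)
  next
    case False
    have "y = v" if "(v, y) \<in> E\<^sup>*" for y
      using that by induction (use False in \<open>auto simp: E_def\<close>)
    then have "connected_rel G `` {v} = {v}"
      using v unfolding rel by auto
    moreover have "\<not> e \<subseteq> {v}" if "e \<in> edges G" for e
      using edge_shape[OF that] by auto
    then have "{e \<in> edges G. e \<subseteq> {v}} = {}"
      by blast
    ultimately show ?thesis
      using C by (auto simp: induced_subgraph_def)
  qed
qed

section \<open>Labellings that separate vertices at distance at most two\<close>

text \<open>
  The vertices can be colored one after another in any order: at most \<open>k\<close> of the \<open>k + 1\<close> colors
  are blocked when a vertex has its turn.
\<close>

lemma greedy_colouring:
  fixes R :: "'a \<Rightarrow> 'a \<Rightarrow> bool"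
  assumes "finite V"
    and "symp R"
    and "\<And>v. v \<in> V \<Longrightarrow> card {u \<in> V. R v u} \<le> k"
  shows "\<exists>f. (\<forall>v\<in>V. f v \<le> k) \<and> (\<forall>u\<in>V. \<forall>v\<in>V. u \<noteq> v \<longrightarrow> R u v \<longrightarrow> f u \<noteq> f v)"
  using assms(1,3)
proof (induction V rule: finite_induct)
  case (insert x V)
  have few: "card {u \<in> V. R v u} \<le> k" if "v \<in> insert x V" for v
  proof -
    have "card {u \<in> V. R v u} \<le> card {u \<in> insert x V. R v u}"
      using insert.hyps(1) by (intro card_mono) auto
    then show ?thesis
      using insert.prems[OF that] by linarith
  qed
  then obtain f where f: "\<forall>v\<in>V. f v \<le> k"
      "\<forall>u\<in>V. \<forall>v\<in>V. u \<noteq> v \<longrightarrow> R u v \<longrightarrow> f u \<noteq> f v"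
    using insert.IH by auto
  have "card (f ` {u \<in> V. R x u}) \<le> card {u \<in> V. R x u}"
    using insert.hyps(1) by (simp add: card_image_le)
  also have "\<dots> \<le> k"
    using few by blast
  finally have "\<not> {..k} \<subseteq> f ` {u \<in> V. R x u}"
    using insert.hyps(1) card_mono[of "f ` {u \<in> V. R x u}" "{..k}"] by auto
  then obtain c where c: "c \<le> k" "c \<notin> f ` {u \<in> V. R x u}"
    by auto
  have "f u \<noteq> c" if "u \<in> V" "R x u \<or> R u x" for u
    using c that \<open>symp R\<close> by (auto dest: sympD)
  then show ?case
    using f c(1) insert.hyps(2) by (intro exI[of _ "f(x := c)"]) auto
qed simp

text \<open>
  Around a vertex \<open>v\<close>, each neighbor \<open>x\<close> accounts for at most \<open>D\<close> vertices within distance two: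
  \<open>x\<close> itself and the neighbors of \<open>x\<close> other than \<open>v\<close>. This gives \<open>D\<^sup>2\<close> conflicts in total.
\<close>

lemma distance_two_labelling:
  assumes graph: "is_graph G" and deg: "\<And>v. v \<in> verts G \<Longrightarrow> degree G v \<le> D"
  shows "\<exists>f. (\<forall>v\<in>verts G. f v \<le> D\<^sup>2) \<and>
             (\<forall>u v. {u, v} \<in> edges G \<longrightarrow> f u \<noteq> f v) \<and>
             (\<forall>u v x. {x, u} \<in> edges G \<longrightarrow> {x, v} \<in> edges G \<longrightarrow> u \<noteq> v \<longrightarrow> f u \<noteq> f v)"
proof -
  define N where "N v = {u. {v, u} \<in> edges G}" for v
  define R where "R u v \<longleftrightarrow> u \<noteq> v \<and> (v \<in> N u \<or> (\<exists>x. x \<in> N u \<and> v \<in> N x))" for u v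
  have fin: "finite (verts G)"
    using graph by (simp add: is_graph_def)
  have edgeD: "x \<noteq> y \<and> x \<in> verts G \<and> y \<in> verts G" if "{x, y} \<in> edges G" for x y
    using graph that unfolding is_graph_def by (metis doubleton_eq_iff)
  have "edges G \<subseteq> Pow (verts G)"
    using graph by (auto simp: is_graph_def)
  then have finE: "finite (edges G)"
    using fin by (meson finite_Pow_iff finite_subset)
  have N_sym: "u \<in> N v \<longleftrightarrow> v \<in> N u" for u v
    by (simp add: N_def insert_commute)
  have N_verts: "N v \<subseteq> verts G" for v
    using edgeD by (auto simp: N_def)
  then have finN: "finite (N v)" for v
    using fin finite_subset by blast
  have cardN: "card (N v) \<le> D" if "v \<in> verts G" for v
  proof -
    have "inj_on (\<lambda>u. {v, u}) (N v)"
      by (auto simp: inj_on_def doubleton_eq_iff)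
    then have "card (N v) \<le> card {e \<in> edges G. v \<in> e}"
      by (rule card_inj_on_le) (use finE in \<open>auto simp: N_def\<close>)
    also have "\<dots> \<le> D"
      using deg[OF that] by (simp add: degree_def)
    finally show ?thesis .
  qed
  have cardR: "card {u \<in> verts G. R v u} \<le> D\<^sup>2" if v: "v \<in> verts G" for v
  proof -
    let ?B = "\<lambda>x. insert x (N x - {v})"
    have B: "card (?B x) \<le> D" if "x \<in> N v" for x
    proof -
      have "v \<in> N x" using that N_sym by blast
      then have "card (N x - {v}) = card (N x) - 1" and "card (N x) > 0"
        using finN[of x] by (auto simp: card_gt_0_iff)
      moreover have "card (N x) \<le> D"
        using that N_verts cardN by blast
      ultimately have "card (N x - {v}) + 1 \<le> D" by linarith
      then show ?thesis
        using card_insert_le_m1[of D "N x - {v}" x] by fastforce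
    qed
    have "{u \<in> verts G. R v u} \<subseteq> (\<Union>x\<in>N v. ?B x)"
      by (auto simp: R_def)
    then have "card {u \<in> verts G. R v u} \<le> card (\<Union>x\<in>N v. ?B x)"
      using finN by (intro card_mono) auto
    also have "\<dots> \<le> (\<Sum>x\<in>N v. card (?B x))"
      by (rule card_UN_le[OF finN])
    also have "\<dots> \<le> card (N v) * D"
      using sum_bounded_above[of "N v" "\<lambda>x. card (?B x)" D] B by simp
    also have "\<dots> \<le> D\<^sup>2"
      using cardN[OF v] by (simp add: power2_eq_square)
    finally show ?thesis .
  qed
  have "symp R"
    using N_sym by (auto simp: symp_def R_def)
  then obtain f where f: "\<forall>v\<in>verts G. f v \<le> D\<^sup>2"
      "\<forall>u\<in>verts G. \<forall>v\<in>verts G. u \<noteq> v \<longrightarrow> R u v \<longrightarrow> f u \<noteq> f v"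
    using greedy_colouring[of "verts G" R "D\<^sup>2"] fin cardR by blast
  have "f u \<noteq> f v" if "{u, v} \<in> edges G" for u v
    using f(2) that edgeD[OF that] by (auto simp: R_def N_def)
  moreover have "f u \<noteq> f v" if "{x, u} \<in> edges G" "{x, v} \<in> edges G" "u \<noteq> v" for u v x
  proof -
    have "x \<in> N u" "v \<in> N x"
      using that by (auto simp: N_def insert_commute)
    then show ?thesis
      using f(2) that(3) edgeD[OF that(1)] edgeD[OF that(2)] by (auto simp: R_def)
  qed
  ultimately show ?thesis
    using f(1) by blast
qed

section \<open>Splittings from labellings\<close>

lemma strict_maximum_unique:
  fixes x :: "'c \<Rightarrow> int"
  assumes M: "finite M" "i \<in> M" and less: "\<And>j. j \<in> M \<Longrightarrow> j \<noteq> i \<Longrightarrow> x j < x i"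
  shows "has_maximum M x" and "j \<in> M \<Longrightarrow> Max (x ` M) = x j \<longleftrightarrow> j = i"
proof -
  have le: "x j \<le> x i" if "j \<in> M" for j
    using less[OF that] by (cases "j = i") auto
  show "has_maximum M x"
    unfolding has_maximum_def
  proof (rule ex1I[of _ i])
    show "j = i" if "j \<in> M \<and> (\<forall>k\<in>M. x k \<le> x j)" for j
      using that M(2) less[of j] by fastforce
  qed (use M(2) le in auto)
  have "Max (x ` M) = x i"
    using M le by (intro Max_eqI) auto
  then show "Max (x ` M) = x j \<longleftrightarrow> j = i" if "j \<in> M"
    using less[OF that] by force
qed

text \<open>
  The map \<open>S\<close> names the pair of labels that a color stands for, with \<open>S i = {}\<close> for a dummy color
  \<open>i\<close>. The bound on \<open>card (S i)\<close> ensures that an edge has weight 2 only at the color whose pair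
  consists of exactly its two labels.
\<close>

lemma splitting_from_labelling:
  assumes graph: "is_graph G" and M: "finite M"
    and S: "\<And>i. i \<in> M \<Longrightarrow> finite (S i) \<and> card (S i) \<le> 2"
    and ex1: "\<And>u v. {u, v} \<in> edges G \<Longrightarrow> \<exists>!i. i \<in> M \<and> S i = {f u, f v}"
    and adjacent: "\<And>u v. {u, v} \<in> edges G \<Longrightarrow> f u \<noteq> f v"
    and two_step: "\<And>u v x. {x, u} \<in> edges G \<Longrightarrow> {x, v} \<in> edges G \<Longrightarrow> u \<noteq> v \<Longrightarrow> f u \<noteq> f v"
  shows "\<exists>H. is_splitting G M H \<and> (\<forall>i\<in>M. disjoint_union_of_edges_and_vertices (H i))"
proof -
  define w where "w v i = (if f v \<in> S i then 1 else 0 :: int)" for v i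
  have edge_max: "has_maximum M (edge_weight w {u, v})"
      "i \<in> M \<Longrightarrow> Max (edge_weight w {u, v} ` M) = edge_weight w {u, v} i \<longleftrightarrow> S i = {f u, f v}"
    if uv: "{u, v} \<in> edges G" for u v i
  proof -
    have ew: "edge_weight w {u, v} j = w u j + w v j" for j
    proof -
      have "u \<noteq> v" using adjacent[OF uv] by blast
      then show ?thesis by (simp add: edge_weight_def)
    qed
    obtain c where c: "c \<in> M" "S c = {f u, f v}" and uniq: "\<And>j. j \<in> M \<Longrightarrow> S j = {f u, f v} \<Longrightarrow> j = c"
      using ex1[OF uv] by blast
    have lt: "edge_weight w {u, v} j < edge_weight w {u, v} c" if j: "j \<in> M" "j \<noteq> c" for j
    proof -
      have "\<not> {f u, f v} \<subseteq> S j"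
        using uniq[of j] j S[of j] card_seteq[of "S j" "{f u, f v}"] adjacent[OF uv] by auto
      then show ?thesis
        using c(2) by (auto simp: ew w_def)
    qed
    show "has_maximum M (edge_weight w {u, v})"
      by (rule strict_maximum_unique(1)[where x = "edge_weight w {u, v}", OF M c(1) lt])
    show "Max (edge_weight w {u, v} ` M) = edge_weight w {u, v} i \<longleftrightarrow> S i = {f u, f v}" if "i \<in> M"
      using strict_maximum_unique(2)[where x = "edge_weight w {u, v}", OF M c(1) lt that] uniq[OF that] c(2) by auto
  qed
  have edge_shape: "\<exists>u v. e = {u, v}" if "e \<in> edges G" for e
    using graph that unfolding is_graph_def by blast
  have "is_splitting G M (split_graph G M w)"
    using M edge_max(1) edge_shape unfolding is_splitting_def by blast
  moreover have "disjoint_union_of_edges_and_vertices (split_graph G M w i)" if i: "i \<in> M" for i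
  proof (rule matching_is_disjoint_union)
    show "is_graph (split_graph G M w i)"
      using graph by (auto simp: is_graph_def split_graph_def)
    fix u v v'
    assume "{u, v} \<in> edges (split_graph G M w i)" "{u, v'} \<in> edges (split_graph G M w i)"
    then have e: "{u, v} \<in> edges G" "{u, v'} \<in> edges G" and "{f u, f v} = {f u, f v'}"
      using edge_max(2)[OF _ i, of u v] edge_max(2)[OF _ i, of u v']
      by (auto simp: split_graph_def)
    then have "f v = f v'"
      by (auto simp: doubleton_eq_iff)
    then show "v = v'"
      using two_step[OF e] by blast
  qed
  ultimately show ?thesis by blast
qed

section \<open>The number of colors\<close>

lemma label_pairs_le_p4:
  assumes "D > 0"
  shows "(D\<^sup>2 + 1) choose 2 \<le> nat (p4 D)"
proof -
  have "int 1 \<le> int (D ^ 3)"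
    using assms by (metis One_nat_def Suc_leI of_nat_mono zero_less_power)
  then have "(int D ^ 2 + 1) * int D ^ 2 + 2 \<le> (int D)^2 * (int D + 1)^2"
    by (simp add: power2_eq_square power3_eq_cube algebra_simps)
  then have "((int D ^ 2 + 1) * int D ^ 2) div 2 \<le> p4 D"
    unfolding p4_def by linarith
  moreover have "int ((D\<^sup>2 + 1) choose 2) = ((int D ^ 2 + 1) * int D ^ 2) div 2"
    by (simp add: choose_two zdiv_int algebra_simps)
  ultimately show ?thesis by linarith
qed

theorem theoremD:
  fixes G :: "'a graph" and D :: nat
  assumes "is_graph G" and "max_degree G = D"
  shows "\<exists>(M :: nat set) H.
           is_splitting G M H \<and> card M = nat (p4 D) \<and>
           (\<forall>i\<in>M. disjoint_union_of_edges_and_vertices (H i))"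
proof -
  have fin: "finite (verts G)"
    using assms(1) by (simp add: is_graph_def)
  have deg: "degree G v \<le> D" if "v \<in> verts G" for v
    using that fin assms(2) by (auto simp: max_degree_def intro: Max_ge)
  obtain f where range: "\<And>v. v \<in> verts G \<Longrightarrow> f v \<le> D\<^sup>2"
    and adjacent: "\<And>u v. {u, v} \<in> edges G \<Longrightarrow> f u \<noteq> f v"
    and two_step: "\<And>u v x. {x, u} \<in> edges G \<Longrightarrow> {x, v} \<in> edges G \<Longrightarrow> u \<noteq> v \<Longrightarrow> f u \<noteq> f v"
    using distance_two_labelling[OF assms(1) deg] by metis
  have ends: "u \<in> verts G \<and> v \<in> verts G" if "{u, v} \<in> edges G" for u v
    using assms(1) that unfolding is_graph_def by (metis doubleton_eq_iff)
  define P where "P = {p. p \<subseteq> {..D\<^sup>2} \<and> card p = 2}"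
  define K where "K = (D\<^sup>2 + 1) choose 2"
  have finP: "finite P"
    by (rule finite_subset[of _ "Pow {..D\<^sup>2}"]) (auto simp: P_def)
  have "card P = K"
    unfolding P_def K_def by (subst n_subsets) auto
  then obtain g where g: "bij_betw g {..<K} P"
    using ex_bij_betw_nat_finite[OF finP] by (auto simp: atLeast0LessThan)
  define S where "S i = (if i < K then g i else {})" for i
  let ?M = "{..<nat (p4 D)}"
  \<comment> \<open>An edge makes the degree positive, which is when the colors suffice for all label pairs.\<close>
  have enough: "K \<le> nat (p4 D)" if "{u, v} \<in> edges G" for u v
  proof -
    have "f u \<le> D\<^sup>2" "f v \<le> D\<^sup>2" "f u \<noteq> f v"
      using ends[OF that] range adjacent[OF that] by auto
    then have "D > 0" by (cases "D = 0") auto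
    then show ?thesis
      unfolding K_def by (rule label_pairs_le_p4)
  qed
  have "\<exists>H. is_splitting G ?M H \<and> (\<forall>i\<in>?M. disjoint_union_of_edges_and_vertices (H i))"
  proof (rule splitting_from_labelling[OF assms(1)])
    show "finite (S i) \<and> card (S i) \<le> 2" for i
      using bij_betwE[OF g] by (auto simp: S_def P_def intro: finite_subset)
    show "\<exists>!i. i \<in> ?M \<and> S i = {f u, f v}" if uv: "{u, v} \<in> edges G" for u v
    proof -
      have "{f u, f v} \<in> P"
        using range ends[OF uv] adjacent[OF uv] by (auto simp: P_def)
      then obtain c where c: "c < K" "g c = {f u, f v}"
        using g by (auto simp: bij_betw_def image_iff)
      show ?thesis
      proof (rule ex1I[of _ c])
        show "c \<in> ?M \<and> S c = {f u, f v}"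
          using c enough[OF uv] by (auto simp: S_def)
        show "j = c" if "j \<in> ?M \<and> S j = {f u, f v}" for j
          using that c bij_betw_imp_inj_on[OF g]
          by (auto simp: S_def inj_on_def split: if_splits)
      qed
    qed
  qed (use adjacent two_step in auto)
  then obtain H where "is_splitting G ?M H" "\<forall>i\<in>?M. disjoint_union_of_edges_and_vertices (H i)"
    by blast
  then show ?thesis
    by (intro exI[of _ ?M] exI[of _ H]) auto
qed

end
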